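(* Let $M=(V,E,F)$ be a discrete surface with dual $M^*=(V^*,E^*,F^* )$, and let $f,\tilde f:V^*\to\mathbb{R}^3$ form a conjugate pair of minimal surfaces with a non-degenerate admissible Gauss map $N:V\to\mathbb{S}^2$, where $f$ is A-minimal and $\tilde f$ is C-minimal. Write $N=(N_1,N_2,N_3)$ in components, assume $N_3\ne1$ at every vertex, and put $z:=\frac{N_1}{1-N_3}+i\frac{N_2}{1-N_3}:V\to\mathbb{C}$. Let $$\Phi(z):=\frac{az+b}{cz+d},\qquad a,b,c,d\in\mathbb{C},\ ad-bc=1,$$ be a Möbius transformation which maps no point $z(v)$, $v\in V$, to infinity and such that $N_\Phi:V\to\mathbb{S}^2$ defined by $$N_\Phi:=\frac{1}{|\Phi(z)|^2+1}\begin{pmatrix}2\operatorname{Re}\Phi(z)\\2\operatorname{Im}\Phi(z)\\|\Phi(z)|^2-1\end{pmatrix}$$ is admissible. Let $$A_\Phi:=\begin{pmatrix}\frac12(a^2-b^2-c^2+d^2)&\frac i2(a^2+b^2-c^2-d^2)&-ab+cd\\ \frac i2(-a^2+b^2-c^2+d^2)&\frac12(a^2+b^2+c^2+d^2)&i(ab+cd)\\-ac+bd&-i(ac+bd)&ad+bc\end{pmatrix}$$ and define $f_\Phi,\tilde f_\Phi:V^*\to\mathbb{R}^3$ by $$f_\Phi-i\tilde f_\Phi:=A_\Phi(f-i\tilde f).$$ Then $f_\Phi$ is A-minimal and $\tilde f_\Phi$ is C-minimal, and they form a conjugate pair of minimal surfaces with Gauss map $N_\Phi$. (Here $i$ is the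 imaginary unit.)
   Context: A discrete surface is a cell decomposition $M=(V,E,F)$ of an oriented surface, with or without boundary; $V_{int}$ and $E_{int}$ denote the interior vertices and interior edges. $M^*=(V^*,E^*,F^* )$ is the dual cell decomposition: elements of $V^*$ correspond to faces of $M$, and each $i\in V$ corresponds to a dual face $i^*\in F^*$. $e_{ij}$ is the oriented edge from $i$ to $j$; for an interior edge, $e_{ij}^*$ is the dual edge oriented from the right face $\phi_r$ of $e_{ij}$ to its left face $\phi_l$. For $N$ defined on $V$, $dN(e_{ij})=N_j-N_i$; for $f$ defined on $V^*$, $df(e^*_{ij})=f_{\phi_l}-f_{\phi_r}$. Sums $\sum_j$ run over the neighbors $j$ of $i$. A realization is an assignment of positions to vertices; it is non-degenerate if the endpoints of every edge have distinct positions. A realization $N:V\to\mathbb{S}^2\subset\mathbb{R}^3$ is admissible if $N_i\neq -N_j$ for every edge $\{ij\}$. A realization $f:V^*\to\mathbb{R}^3$ is A-minimal with Gauss map $N:V\to\mathbb{S}^2$ if $N$ is admissible and for every interior edge $\{ij\}$: $dN(e_{ij})\times df(e^*_{ij})=0$ and $\langle N_i+N_j, df(e^*_{ij})\rangle=0$. A realization $\tilde f:V^*\to\mathbb{R}^3$ is C-minimal with Gauss map $N:V\to\mathbb{S}^2$ if $N$ is admissible, $\tilde f$ has planar faces with face normal $N$ (i.e. $N_i$ and $N_j$ are both orthogonal to $d\tilde f(e^*_{ij})$ for every interior edge $\{ij\}$), and the scalar mean curvature $\tilde H_i:=\sum_j |d\tilde f(e^*_{ij})|\tan\frac{\alpha_{ij}}{2}$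 vanishes for every $i\in V_{int}$. Here, if $d\tilde f(e^*_{ij})\ne0$, the dihedral angle $\alpha_{ij}\in(-\pi,\pi)$ is determined by $\sin\alpha_{ij}=\langle N_i\times N_j, d\tilde f(e^*_{ij})/|d\tilde f(e^*_{ij})|\rangle$ and $\cos\alpha_{ij}=\langle N_i,N_j\rangle$; if $d\tilde f(e^*_{ij})=0$ the term is $0$. A conjugate pair of minimal surfaces with Gauss map $N$ is a pair $(f,\tilde f)$ with $f$ A-minimal and $\tilde f$ C-minimal, both with Gauss map $N$, such that $d\tilde f(e^*_{ij})=N_i\times df(e^*_{ij})=N_j\times df(e^*_{ij})$ for every interior edge $\{ij\}$. *)

theory Defs
  imports "HOL-Analysis.Analysis" "HOL-Combinatorics.Orbits"
begin

unbundle cross3_syntax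

section \<open>Discrete surfaces\<close>

text \<open>
  A cell decomposition of an oriented surface is encoded as a combinatorial map: every unoriented
  edge is a pair of opposite oriented edges (darts). The dart following \<open>e\<close> on the boundary of the
  face to the left of \<open>e\<close> is \<open>face_next e\<close>. If \<open>e\<close> is an oriented edge of the boundary of the surface
  with no face on its left, then \<open>left_face e = None\<close> and \<open>face_next e\<close> is the following such dart of
  the same boundary component. The right face of \<open>e\<close> is the left face of its opposite. Loops and
  multiple edges are not excluded, and the decomposition may be infinite.
\<close>

record ('v, 'e, 'f) cell_decomposition =
  vertices :: "'v set"
  darts :: "'e set"
  faces :: "'f set"
  origin :: "'e \<Rightarrow> 'v"
  opposite :: "'e \<Rightarrow> 'e"
  face_next :: "'e \<Rightarrow> 'e"
  left_face :: "'e \<Rightarrow> 'f option"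

definition target :: "('v, 'e, 'f) cell_decomposition \<Rightarrow> 'e \<Rightarrow> 'v" where
  "target M e = origin M (opposite M e)"

definition right_face :: "('v, 'e, 'f) cell_decomposition \<Rightarrow> 'e \<Rightarrow> 'f option" where
  "right_face M e = left_face M (opposite M e)"

definition star :: "('v, 'e, 'f) cell_decomposition \<Rightarrow> 'v \<Rightarrow> 'e set" where
  "star M v = {e \<in> darts M. origin M e = v}"

text \<open>
  The map \<open>face_next \<circ> opposite\<close> turns an outgoing dart clockwise to the next one at the same vertex.
  The condition \<open>cyclic_on\<close> says that the set is one finite nonempty cycle; so the darts at a vertex,
  respectively around a face, form exactly one cycle. By \<open>boundary_vertex\<close>, the faces around a vertex
  form a single fan (a half-disc) if the vertex is on the boundary, and a disc otherwise.
\<close>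

locale discrete_surface =
  fixes M :: "('v, 'e, 'f) cell_decomposition"
  assumes origin_in: "e \<in> darts M \<Longrightarrow> origin M e \<in> vertices M"
    and opposite_in: "e \<in> darts M \<Longrightarrow> opposite M e \<in> darts M"
    and opposite_neq: "e \<in> darts M \<Longrightarrow> opposite M e \<noteq> e"
    and opposite_opposite: "e \<in> darts M \<Longrightarrow> opposite M (opposite M e) = e"
    and left_face_in: "e \<in> darts M \<Longrightarrow> left_face M e = Some \<phi> \<Longrightarrow> \<phi> \<in> faces M"
    and vertex_cycle: "v \<in> vertices M \<Longrightarrow> cyclic_on (face_next M \<circ> opposite M) (star M v)"
    and face_cycle: "\<phi> \<in> faces M \<Longrightarrow> cyclic_on (face_next M) {e \<in> darts M. left_face M e = Some \<phi>}"
    and boundary_next: "e \<in> darts M \<Longrightarrow> left_face M e = None \<Longrightarrow> left_face M (face_next M e) = None"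
    and edge_has_face: "e \<in> darts M \<Longrightarrow> left_face M e \<noteq> None \<or> right_face M e \<noteq> None"
    and boundary_vertex:
      "e \<in> star M v \<Longrightarrow> e' \<in> star M v \<Longrightarrow> left_face M e = None \<Longrightarrow> left_face M e' = None \<Longrightarrow> e = e'"

definition interior_darts :: "('v, 'e, 'f) cell_decomposition \<Rightarrow> 'e set" where
  "interior_darts M = {e \<in> darts M. left_face M e \<noteq> None \<and> right_face M e \<noteq> None}"

definition interior_vertices :: "('v, 'e, 'f) cell_decomposition \<Rightarrow> 'v set" where
  "interior_vertices M = {v \<in> vertices M. \<forall>e \<in> star M v. left_face M e \<noteq> None}"

definition vdiff :: "('v, 'e, 'f) cell_decomposition \<Rightarrow> ('v \<Rightarrow> real^3) \<Rightarrow> 'e \<Rightarrow> real^3" where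
  "vdiff M N e = N (target M e) - N (origin M e)"

text \<open>
  The vertices of the dual decomposition are the faces of \<open>M\<close>. The increment along the dual edge of
  an interior dart is taken from the right face to the left face.
\<close>

definition dual_diff :: "('v, 'e, 'f) cell_decomposition \<Rightarrow> ('f \<Rightarrow> real^3) \<Rightarrow> 'e \<Rightarrow> real^3" where
  "dual_diff M f e = f (the (left_face M e)) - f (the (right_face M e))"


section \<open>A-minimal and C-minimal surfaces\<close>

definition nondegenerate :: "('v, 'e, 'f) cell_decomposition \<Rightarrow> ('v \<Rightarrow> real^3) \<Rightarrow> bool" where
  "nondegenerate M N \<longleftrightarrow> (\<forall>e \<in> darts M. N (origin M e) \<noteq> N (target M e))"

definition admissible :: "('v, 'e, 'f) cell_decomposition \<Rightarrow> ('v \<Rightarrow> real^3) \<Rightarrow> bool" where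
  "admissible M N \<longleftrightarrow>
     (\<forall>v \<in> vertices M. N v \<in> sphere 0 1) \<and>
     (\<forall>e \<in> darts M. N (origin M e) \<noteq> - N (target M e))"

definition A_minimal ::
    "('v, 'e, 'f) cell_decomposition \<Rightarrow> ('f \<Rightarrow> real^3) \<Rightarrow> ('v \<Rightarrow> real^3) \<Rightarrow> bool" where
  "A_minimal M f N \<longleftrightarrow>
     admissible M N \<and>
     (\<forall>e \<in> interior_darts M.
        vdiff M N e \<times> dual_diff M f e = 0 \<and>
        (N (origin M e) + N (target M e)) \<bullet> dual_diff M f e = 0)"

text \<open>
  The angle is only meaningful if the dual edge does not degenerate. In the mean curvature a
  degenerate dual edge contributes zero because of the factor \<open>norm\<close>.
\<close>

definition dihedral_angle ::
    "('v, 'e, 'f) cell_decomposition \<Rightarrow> ('f \<Rightarrow> real^3) \<Rightarrow> ('v \<Rightarrow> real^3) \<Rightarrow> 'e \<Rightarrow> real" where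
  "dihedral_angle M f N e =
     (THE \<alpha>. - pi < \<alpha> \<and> \<alpha> < pi \<and>
        sin \<alpha> = (N (origin M e) \<times> N (target M e)) \<bullet> (dual_diff M f e /\<^sub>R norm (dual_diff M f e)) \<and>
        cos \<alpha> = N (origin M e) \<bullet> N (target M e))"

definition mean_curvature ::
    "('v, 'e, 'f) cell_decomposition \<Rightarrow> ('f \<Rightarrow> real^3) \<Rightarrow> ('v \<Rightarrow> real^3) \<Rightarrow> 'v \<Rightarrow> real" where
  "mean_curvature M f N v =
     (\<Sum>e \<in> star M v. norm (dual_diff M f e) * tan (dihedral_angle M f N e / 2))"

definition planar_faces_with_normal ::
    "('v, 'e, 'f) cell_decomposition \<Rightarrow> ('f \<Rightarrow> real^3) \<Rightarrow> ('v \<Rightarrow> real^3) \<Rightarrow> bool" where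
  "planar_faces_with_normal M f N \<longleftrightarrow>
     (\<forall>e \<in> interior_darts M.
        N (origin M e) \<bullet> dual_diff M f e = 0 \<and> N (target M e) \<bullet> dual_diff M f e = 0)"

definition C_minimal ::
    "('v, 'e, 'f) cell_decomposition \<Rightarrow> ('f \<Rightarrow> real^3) \<Rightarrow> ('v \<Rightarrow> real^3) \<Rightarrow> bool" where
  "C_minimal M f N \<longleftrightarrow>
     admissible M N \<and> planar_faces_with_normal M f N \<and>
     (\<forall>v \<in> interior_vertices M. mean_curvature M f N v = 0)"

definition conjugate_pair ::
    "('v, 'e, 'f) cell_decomposition \<Rightarrow> ('f \<Rightarrow> real^3) \<Rightarrow> ('f \<Rightarrow> real^3) \<Rightarrow> ('v \<Rightarrow> real^3) \<Rightarrow> bool" where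
  "conjugate_pair M f g N \<longleftrightarrow>
     A_minimal M f N \<and> C_minimal M g N \<and>
     (\<forall>e \<in> interior_darts M.
        dual_diff M g e = N (origin M e) \<times> dual_diff M f e \<and>
        dual_diff M g e = N (target M e) \<times> dual_diff M f e)"


section \<open>Stereographic projection and the matrix of a Moebius transformation\<close>

definition stereo :: "real^3 \<Rightarrow> complex" where
  "stereo n = Complex (n $ 1 / (1 - n $ 3)) (n $ 2 / (1 - n $ 3))"

definition inv_stereo :: "complex \<Rightarrow> real^3" where
  "inv_stereo w = (1 / ((cmod w)\<^sup>2 + 1)) *\<^sub>R vector [2 * Re w, 2 * Im w, (cmod w)\<^sup>2 - 1]"

definition moebius_matrix :: "complex \<Rightarrow> complex \<Rightarrow> complex \<Rightarrow> complex \<Rightarrow> complex^3^3" where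
  "moebius_matrix a b c d = vector
    [vector [1/2 * (a\<^sup>2 - b\<^sup>2 - c\<^sup>2 + d\<^sup>2), \<i>/2 * (a\<^sup>2 + b\<^sup>2 - c\<^sup>2 - d\<^sup>2), - a * b + c * d],
     vector [\<i>/2 * (- a\<^sup>2 + b\<^sup>2 - c\<^sup>2 + d\<^sup>2), 1/2 * (a\<^sup>2 + b\<^sup>2 + c\<^sup>2 + d\<^sup>2), \<i> * (a * b + c * d)],
     vector [- a * c + b * d, - \<i> * (a * c + b * d), a * d + b * c]]"

definition complex_vec :: "real^3 \<Rightarrow> complex^3" where
  "complex_vec x = (\<chi> k. complex_of_real (x $ k))"

end

theory Submission
  imports Defs
begin

text \<open>
  Consider one interior edge with Gauss images \<open>m\<close> and \<open>n\<close>. Since \<open>n - m \<noteq> 0\<close>, the equation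
  \<open>dN \<times> df = 0\<close> forces \<open>df = k (n - m)\<close> for a real \<open>k\<close>, and conjugacy then forces
  \<open>df' = k (m \<times> n)\<close>. Conversely, for unit vectors \<open>m \<noteq> - n\<close> and any real \<open>k\<close>, increments of this
  form satisfy all the equations demanded of an edge (\<open>conjugate_increments_equations\<close>), and the edge
  contributes \<open>k (1 - m \<bullet> n)\<close> to the mean curvature, because \<open>tan (\<alpha>/2) = sin \<alpha> / (1 + cos \<alpha>)\<close>
  (\<open>mean_curvature_term\<close>). So a conjugate pair is encoded by a real weight \<open>k (1 - m \<bullet> n)\<close> on every
  interior edge, with vanishing sum around each interior vertex.

  In the stereographic coordinates \<open>z\<close>, \<open>w\<close> of \<open>m\<close>, \<open>n\<close> the holomorphic structure becomes visible:
  \<open>(n - m) - \<i> (m \<times> n) = (1 - m \<bullet> n) p(z,w)\<close> with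
  \<open>p(z,w) = (1 - z w, \<i> (1 + z w), z + w) / (w - z)\<close>
  (\<open>complex_chord\<close>), so that \<open>d(f - \<i> f')\<close> is the weight of the edge times \<open>p(z,w)\<close>. The entries of
  \<open>p(z,w)\<close> are linear in the coefficients of the quadratic polynomial with roots \<open>z\<close> and \<open>w\<close>, and
  the matrix \<open>A\<close> belonging to the Moebius transformation \<open>\<Phi>\<close> is its action on such polynomials:
  \<open>A p(z,w) = p(\<Phi> z, \<Phi> w)\<close> (\<open>moebius_matrix_point_pair_vector\<close>). Hence the transformed
  increments arise in the same way from the transformed Gauss map with the same edge weights, and
  both the edge equations and the vanishing of the mean curvature persist.
\<close>

section \<open>Stereographic projection\<close>

lemma cmod_square_plus_one_nonzero: "(cmod z)\<^sup>2 + 1 \<noteq> 0"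
  by (smt (verit) zero_le_power2)

lemma inv_stereo_components:
  "inv_stereo z $ 1 = 2 * Re z / ((cmod z)\<^sup>2 + 1)"
  "inv_stereo z $ 2 = 2 * Im z / ((cmod z)\<^sup>2 + 1)"
  "inv_stereo z $ 3 = ((cmod z)\<^sup>2 - 1) / ((cmod z)\<^sup>2 + 1)"
  by (simp_all add: inv_stereo_def)

text \<open>
  In terms of \<open>z\<close> and its conjugate the components are rational functions, so that identities
  between them reduce to polynomial identities over the complex numbers.
\<close>

lemma complex_inv_stereo_components:
  "complex_of_real (inv_stereo z $ 1) = (z + cnj z) / (z * cnj z + 1)"
  "complex_of_real (inv_stereo z $ 2) = - \<i> * (z - cnj z) / (z * cnj z + 1)"
  "complex_of_real (inv_stereo z $ 3) = (z * cnj z - 1) / (z * cnj z + 1)"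
proof -
  have n: "z * cnj z = complex_of_real ((cmod z)\<^sup>2)"
    by (rule complex_norm_square[symmetric])
  show "complex_of_real (inv_stereo z $ 1) = (z + cnj z) / (z * cnj z + 1)"
    unfolding n inv_stereo_components by (simp add: complex_add_cnj)
  show "complex_of_real (inv_stereo z $ 3) = (z * cnj z - 1) / (z * cnj z + 1)"
    unfolding n inv_stereo_components by simp
  show "complex_of_real (inv_stereo z $ 2) = - \<i> * (z - cnj z) / (z * cnj z + 1)"
    unfolding n inv_stereo_components by (simp add: complex_diff_cnj algebra_simps)
qed

lemma inv_stereo_stereo:
  assumes "norm n = 1" "n $ 3 \<noteq> 1"
  shows "inv_stereo (stereo n) = n"
proof -
  have "n \<bullet> n = 1"
    using assms(1) by (simp add: dot_square_norm)
  then have sphere: "(n $ 1)\<^sup>2 + (n $ 2)\<^sup>2 = 1 - (n $ 3)\<^sup>2"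
    by (simp add: inner_vec_def sum_3 power2_eq_square)
  have nz: "1 - n $ 3 \<noteq> 0"
    using assms(2) by simp
  have "(cmod (stereo n))\<^sup>2 = ((n $ 1)\<^sup>2 + (n $ 2)\<^sup>2) / (1 - n $ 3)\<^sup>2"
    by (simp add: stereo_def cmod_power2 power_divide add_divide_distrib)
  also have "\<dots> = (1 + n $ 3) / (1 - n $ 3)"
  proof -
    have "1 - (n $ 3)\<^sup>2 = (1 + n $ 3) * (1 - n $ 3)"
      by (simp add: algebra_simps power2_eq_square)
    then show ?thesis
      unfolding sphere using nz by (simp add: power2_eq_square)
  qed
  finally have m: "(cmod (stereo n))\<^sup>2 = (1 + n $ 3) / (1 - n $ 3)" .
  have p: "(cmod (stereo n))\<^sup>2 + 1 = 2 / (1 - n $ 3)"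
    and q: "(cmod (stereo n))\<^sup>2 - 1 = 2 * n $ 3 / (1 - n $ 3)"
    unfolding m using nz by (simp_all add: field_simps)
  show ?thesis
    unfolding vec_eq_iff forall_3 inv_stereo_components p q
    using nz by (simp add: stereo_def)
qed

section \<open>The complexified edge vectors and their transformation\<close>

text \<open>
  Up to normalisation, these are coordinates in \<open>\<complex>\<^sup>3\<close> of the quadratic polynomial
  \<open>x\<^sup>2 - (z + w) x + z w\<close>. The sum of the squares of the three coordinates is its discriminant
  \<open>(w - z)\<^sup>2\<close>, so that the factor in front makes this sum equal to one.
\<close>

definition point_pair_vector :: "complex \<Rightarrow> complex \<Rightarrow> complex^3" where
  "point_pair_vector z w =
     (1 / (w - z)) *s vector [1 - z * w, \<i> * (1 + z * w), z + w]"

text \<open>This is half the squared chordal distance of the two points of the sphere.\<close>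

lemma one_minus_inner_inv_stereo:
  "1 - inv_stereo z \<bullet> inv_stereo w =
     2 * (cmod (w - z))\<^sup>2 / (((cmod z)\<^sup>2 + 1) * ((cmod w)\<^sup>2 + 1))"
proof -
  have "(Re z)\<^sup>2 + (Im z)\<^sup>2 + 1 \<noteq> 0" "(Re w)\<^sup>2 + (Im w)\<^sup>2 + 1 \<noteq> 0"
    using cmod_square_plus_one_nonzero[of z] cmod_square_plus_one_nonzero[of w]
    by (simp_all add: cmod_power2)
  then show ?thesis
    unfolding inner_vec_def sum_3 inner_real_def inv_stereo_components cmod_power2
    by (simp add: divide_simps) (simp add: power2_eq_square algebra_simps)
qed

text \<open>
  A scalar can be split off that leaves a vector depending holomorphically on both points: the anti-holomorphic dependence on \<open>z\<close> and \<open>w\<close> is confined to the factor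
  \<open>2 (w - z) (cnj w - cnj z) / ((z cnj z + 1) (w cnj w + 1))\<close>, which is real. This is why the matrix
  of a Moebius transformation, holomorphic in its coefficients, can act on the pair of surfaces.
\<close>

lemma complex_chord:
  assumes "z \<noteq> w"
  shows "complex_vec (inv_stereo w - inv_stereo z) - \<i> *s complex_vec (inv_stereo z \<times> inv_stereo w) =
           complex_of_real (1 - inv_stereo z \<bullet> inv_stereo w) *s point_pair_vector z w"
proof -
  have norm_sq: "complex_of_real ((cmod z)\<^sup>2) = z * cnj z" for z
    by (rule complex_norm_square)
  have nonzero: "z * cnj z + 1 \<noteq> 0" for z
  proof -
    have "complex_of_real ((cmod z)\<^sup>2 + 1) \<noteq> 0"
      by (simp only: of_real_eq_0_iff cmod_square_plus_one_nonzero not_False_eq_True)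
    then show ?thesis
      by (simp only: of_real_add norm_sq of_real_1 not_False_eq_True)
  qed
  \<comment> \<open>With the conjugates named, what remains is an identity of rational functions in four independent
     variables.\<close>
  define u v where "u = cnj z" and "v = cnj w"
  have nz: "1 + z * u \<noteq> 0" "1 + w * v \<noteq> 0" "w - z \<noteq> 0"
    using nonzero[of z] nonzero[of w] assms by (auto simp: u_def v_def add.commute)
  have weight: "complex_of_real (1 - inv_stereo z \<bullet> inv_stereo w) =
      2 * (w - z) * (v - u) / ((1 + z * u) * (1 + w * v))"
    unfolding one_minus_inner_inv_stereo of_real_divide of_real_mult of_real_add norm_sq
    by (simp add: u_def v_def add.commute mult.assoc)
  have ii: "\<i> * (\<i> * x) = - x" for x
    by (metis i_squared mult.assoc mult_minus1)
  show ?thesis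
    unfolding weight vec_eq_iff forall_3
    using nz
    by (simp add: complex_vec_def point_pair_vector_def cross_components complex_inv_stereo_components
          u_def[symmetric] v_def[symmetric] add.commute divide_simps)
       (simp add: algebra_simps ii)
qed

text \<open>
  Substituting a Moebius transformation into a quadratic polynomial moves its roots and multiplies
  it by a scalar. For the vectors \<open>(1 - z w, \<i> (1 + z w), z + w)\<close> this scalar is
  \<open>(c z + d) (c w + d)\<close>, and the normalising factor \<open>1 / (w - z)\<close> changes by exactly the inverse,
  because the determinant is one.
\<close>

lemma moebius_matrix_point_pair_vector:
  assumes det: "a * d - b * c = 1" and "c * z + d \<noteq> 0" "c * w + d \<noteq> 0" "z \<noteq> w"
  shows "moebius_matrix a b c d *v point_pair_vector z w =
           point_pair_vector (moebius a b c d z) (moebius a b c d w)"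
proof -
  define D where "D = (c * z + d) * (c * w + d)"
  have D: "D \<noteq> 0" using assms by (simp add: D_def)
  have "moebius a b c d w - moebius a b c d z = (a * d - b * c) * (w - z) / D"
    using assms(2,3) by (simp add: moebius_def D_def divide_simps) (simp add: algebra_simps)
  then have diff: "moebius a b c d w - moebius a b c d z = (w - z) / D"
    unfolding det by simp
  have ii: "\<i> * (\<i> * x) = - x" for x
    by (metis i_squared mult.assoc mult_minus1)
  have prod: "moebius a b c d z * moebius a b c d w = (a * z + b) * (a * w + b) / D"
    by (simp add: moebius_def D_def)
  have sum: "moebius a b c d z + moebius a b c d w =
      ((a * z + b) * (c * w + d) + (a * w + b) * (c * z + d)) / D"
    using assms(2,3) by (simp add: moebius_def D_def divide_simps)
  show ?thesis
    unfolding point_pair_vector_def diff prod sum vec_eq_iff forall_3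
    using D assms(4)
    by (simp add: matrix_vector_mult_def sum_3 moebius_matrix_def divide_simps)
       (simp add: D_def algebra_simps power2_eq_square ii)
qed

lemma complex_vec_diff: "complex_vec (x - y) = complex_vec x - complex_vec y"
  by (simp add: complex_vec_def vec_eq_iff)

lemma complex_vec_scaleR: "complex_vec (r *\<^sub>R x) = complex_of_real r *s complex_vec x"
  by (simp add: complex_vec_def vec_eq_iff)

lemma complex_vec_parts_eq:
  assumes "complex_vec x - \<i> *s complex_vec y = complex_vec x' - \<i> *s complex_vec y'"
  shows "x = x'" and "y = y'"
  using assms by (auto simp: complex_vec_def vec_eq_iff complex_eq_iff)

section \<open>The contribution of an edge to the mean curvature\<close>

text \<open>
  Let \<open>m\<close> and \<open>n\<close> be the two normals, \<open>t = m \<bullet> n = cos \<alpha>\<close> and \<open>s = norm (m \<times> n)\<close>. Unless the dual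
  edge degenerates, in which case \<open>k = 0\<close> or \<open>t = 1\<close>, one has \<open>sin \<alpha> = sgn k * s\<close>, and the term is
  \<open>\<bar>k\<bar> s sgn k s / (1 + t) = k s\<^sup>2 / (1 + t) = k (1 - t)\<close>. The two signs of \<open>k\<close> cancel, which is why
  the sum defining the mean curvature is linear in \<open>k\<close>.
\<close>

lemma mean_curvature_term:
  assumes "N (origin M e) \<in> sphere 0 1" "N (target M e) \<in> sphere 0 1"
    and "N (origin M e) \<noteq> - N (target M e)"
    and g: "dual_diff M g e = k *\<^sub>R (N (origin M e) \<times> N (target M e))"
  shows "norm (dual_diff M g e) * tan (dihedral_angle M g N e / 2) =
           k * (1 - N (origin M e) \<bullet> N (target M e))"
proof -
  define m n where "m = N (origin M e)" and "n = N (target M e)"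
  define s where "s = norm (m \<times> n)"
  define t where "t = m \<bullet> n"
  have unit: "norm m = 1" "norm n = 1" and mn: "m \<noteq> - n"
    using assms(1-3) by (auto simp: m_def n_def)
  have st: "s\<^sup>2 + t\<^sup>2 = 1"
    using norm_cross_dot[of m n] unit by (simp add: s_def t_def)
  have "t \<noteq> -1"
  proof
    assume "t = -1"
    then have "m \<bullet> (- n) = norm m * norm (- n)"
      using unit by (simp add: t_def)
    then show False
      using mn unit norm_cauchy_schwarz_eq[of m "- n"] by simp
  qed
  then have t: "1 + t \<noteq> 0" by simp
  have g': "dual_diff M g e = k *\<^sub>R (m \<times> n)"
    using g by (simp add: m_def n_def)
  show ?thesis
  proof (cases "dual_diff M g e = 0")
    case True
    have "k * (1 - t) = 0"
    proof (cases "k = 0")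
      case False
      then have "s = 0" using True g' by (simp add: s_def)
      then have "(1 - t) * (1 + t) = 0" using st by (simp add: algebra_simps power2_eq_square)
      then show ?thesis using t by simp
    qed simp
    then show ?thesis
      using True by (simp add: t_def m_def n_def)
  next
    case False
    define \<alpha> where "\<alpha> = dihedral_angle M g N e"
    define y where "y = sgn k * s"
    have s0: "s \<noteq> 0" and k0: "k \<noteq> 0"
      using False g' by (auto simp: s_def)
    have y: "(m \<times> n) \<bullet> (dual_diff M g e /\<^sub>R norm (dual_diff M g e)) = y"
    proof -
      have "(m \<times> n) \<bullet> (dual_diff M g e /\<^sub>R norm (dual_diff M g e)) = k * s\<^sup>2 / (\<bar>k\<bar> * s)"
        unfolding g' by (simp add: s_def dot_square_norm divide_inverse mult_ac)
      also have "\<dots> = y"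
        using s0 k0 by (simp add: y_def sgn_if field_simps power2_eq_square)
      finally show ?thesis .
    qed
    have yt: "t\<^sup>2 + y\<^sup>2 = 1"
      using st k0 by (simp add: y_def power_mult_distrib sgn_if)
    \<comment> \<open>The point \<open>(t, y)\<close> of the unit circle differs from \<open>(-1, 0)\<close>, so its argument can be chosen
       in the open interval.\<close>
    have ex1: "\<exists>!x. - pi < x \<and> x < pi \<and> sin x = y \<and> cos x = t"
    proof -
      obtain x where x: "0 \<le> x" "x < 2 * pi" "t = cos x" "y = sin x"
        using sincos_total_2pi[OF yt] by metis
      have "x \<noteq> pi" using x t by auto
      define x' where "x' = (if x < pi then x else x - 2 * pi)"
      have x': "- pi < x' \<and> x' < pi \<and> sin x' = y \<and> cos x' = t"
        using x \<open>x \<noteq> pi\<close> sin_periodic[of "x - 2 * pi"] cos_periodic[of "x - 2 * pi"]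
        by (auto simp: x'_def)
      show ?thesis
      proof (rule ex1I)
        show "- pi < x' \<and> x' < pi \<and> sin x' = y \<and> cos x' = t" by (fact x')
      next
        fix x2 assume x2: "- pi < x2 \<and> x2 < pi \<and> sin x2 = y \<and> cos x2 = t"
        then have "sin x2 = sin x' \<and> cos x2 = cos x'" using x' by simp
        then obtain j where j: "x2 = x' + 2 * pi * of_int j"
          using sin_cos_eq_iff by metis
        have "\<bar>2 * pi * of_int j\<bar> < 2 * pi * 1"
          using j x2 x' by linarith
        then have "\<bar>real_of_int j\<bar> < 1"
          by (simp add: abs_mult)
        then show "x2 = x'" using j by simp
      qed
    qed
    have "\<alpha> = (THE x. - pi < x \<and> x < pi \<and> sin x = y \<and> cos x = t)"
      unfolding \<alpha>_def dihedral_angle_def m_def[symmetric] n_def[symmetric] y t_def[symmetric] ..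
    with theI'[OF ex1] have \<alpha>: "sin \<alpha> = y" "cos \<alpha> = t"
      by simp_all
    have "norm (dual_diff M g e) * tan (\<alpha> / 2) = \<bar>k\<bar> * s * (sgn k * s / (t + 1))"
      using \<alpha> by (simp add: tan_half g' s_def y_def)
    also have "\<dots> = k * (s\<^sup>2 / (1 + t))"
      by (simp add: power2_eq_square sgn_if add.commute)
    also have "s\<^sup>2 = (1 - t) * (1 + t)"
      using st by (simp add: algebra_simps power2_eq_square)
    also have "k * ((1 - t) * (1 + t) / (1 + t)) = k * (1 - t)"
      using t by simp
    finally show ?thesis
      by (simp add: \<alpha>_def t_def m_def n_def)
  qed
qed

section \<open>Conjugate pairs, edge by edge\<close>

lemma parallel_imp_scaleR:
  fixes x y :: "real^3"
  assumes "x \<times> y = 0" "x \<noteq> 0"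
  obtains k where "y = k *\<^sub>R x"
  using assms by (metis cross_eq_0 collinear_lemma scaleR_zero_left)

text \<open>
  Interior vertices are defined through the left faces of their outgoing edges. The right face of
  such an edge is there as well: otherwise the boundary would continue along the next outgoing edge,
  which would have no left face.
\<close>

lemma (in discrete_surface) star_subset_interior_darts:
  assumes "v \<in> interior_vertices M"
  shows "star M v \<subseteq> interior_darts M"
proof
  fix e assume e: "e \<in> star M v"
  then have dart: "e \<in> darts M" by (simp add: star_def)
  have "face_next M (opposite M e) \<in> star M v"
    using cyclic_on_inI[OF vertex_cycle e] assms by (simp add: interior_vertices_def)
  then have "left_face M (face_next M (opposite M e)) \<noteq> None"
    using assms by (simp add: interior_vertices_def)
  then have "right_face M e \<noteq> None"
    using boundary_next[OF opposite_in[OF dart]] by (metis right_face_def)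
  then show "e \<in> interior_darts M"
    using assms e dart by (auto simp: interior_darts_def interior_vertices_def)
qed

text \<open>
  Here \<open>m\<close> and \<open>n\<close> are the Gauss images of the ends of an edge, \<open>x\<close> and \<open>y\<close> the increments of the
  A-minimal and of the C-minimal surface across it. They share the coefficient \<open>k\<close>, so that \<open>x - \<i> y\<close>
  is a real multiple of one complex vector determined by the Gauss map.
\<close>

definition conjugate_increments :: "real^3 \<Rightarrow> real^3 \<Rightarrow> real \<Rightarrow> real^3 \<Rightarrow> real^3 \<Rightarrow> bool" where
  "conjugate_increments m n k x y \<longleftrightarrow> x = k *\<^sub>R (n - m) \<and> y = k *\<^sub>R (m \<times> n)"

lemma conjugate_pair_imp_conjugate_increments:
  assumes conj: "conjugate_pair M f g N" and "nondegenerate M N" and e: "e \<in> interior_darts M"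
  obtains k where
    "conjugate_increments (N (origin M e)) (N (target M e)) k (dual_diff M f e) (dual_diff M g e)"
proof -
  have "vdiff M N e \<times> dual_diff M f e = 0"
    and g: "dual_diff M g e = N (origin M e) \<times> dual_diff M f e"
    using conj e by (auto simp: conjugate_pair_def A_minimal_def)
  moreover have "vdiff M N e \<noteq> 0"
    using \<open>nondegenerate M N\<close> e by (auto simp: nondegenerate_def vdiff_def interior_darts_def)
  ultimately obtain k where k: "dual_diff M f e = k *\<^sub>R (N (target M e) - N (origin M e))"
    using parallel_imp_scaleR unfolding vdiff_def by metis
  show ?thesis
    by (rule that[of k]) (simp add: conjugate_increments_def g k cross_mult_right Cross3.right_diff_distrib)
qed

text \<open>
  The coefficient \<open>k\<close> itself is not preserved, since the transformation changes chord lengths; the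
  product \<open>k (1 - m \<bullet> n)\<close> is, because it is the scalar in front of \<open>point_pair_vector\<close>, on which the
  matrix acts without any factor. That this scalar is real allows the new increments to be read off
  as real and imaginary parts.
\<close>

lemma conjugate_increments_moebius:
  assumes edge: "conjugate_increments (inv_stereo z) (inv_stereo w) k x y"
    and moved: "complex_vec x' - \<i> *s complex_vec y' =
                  moebius_matrix a b c d *v (complex_vec x - \<i> *s complex_vec y)"
    and det: "a * d - b * c = 1" and fin: "c * z + d \<noteq> 0" "c * w + d \<noteq> 0" and "z \<noteq> w"
  obtains k' where
    "conjugate_increments (inv_stereo (moebius a b c d z)) (inv_stereo (moebius a b c d w)) k' x' y'"
    "k' * (1 - inv_stereo (moebius a b c d z) \<bullet> inv_stereo (moebius a b c d w)) =
       k * (1 - inv_stereo z \<bullet> inv_stereo w)"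
proof -
  define Z W where "Z = moebius a b c d z" and "W = moebius a b c d w"
  define q where "q = k * (1 - inv_stereo z \<bullet> inv_stereo w)"
  define k' where "k' = q / (1 - inv_stereo Z \<bullet> inv_stereo W)"
  have "moebius d (- b) (- c) a Z = z" "moebius d (- b) (- c) a W = w"
    using det fin by (auto simp: Z_def W_def intro!: moebius_inverse)
  then have "Z \<noteq> W" using \<open>z \<noteq> w\<close> by auto
  have "1 - inv_stereo Z \<bullet> inv_stereo W \<noteq> 0"
    using \<open>Z \<noteq> W\<close> cmod_square_plus_one_nonzero[of Z] cmod_square_plus_one_nonzero[of W]
    by (simp add: one_minus_inner_inv_stereo)
  then have q: "k' * (1 - inv_stereo Z \<bullet> inv_stereo W) = q"
    by (simp add: k'_def)
  have "complex_vec x - \<i> *s complex_vec y = complex_of_real k *s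
      (complex_vec (inv_stereo w - inv_stereo z) - \<i> *s complex_vec (inv_stereo z \<times> inv_stereo w))"
    unfolding edge[unfolded conjugate_increments_def, THEN conjunct1]
      edge[unfolded conjugate_increments_def, THEN conjunct2] complex_vec_scaleR
    by (simp add: vec_eq_iff algebra_simps)
  also have "\<dots> = complex_of_real q *s point_pair_vector z w"
    unfolding complex_chord[OF \<open>z \<noteq> w\<close>] q_def by (simp only: vector_smult_assoc of_real_mult)
  finally have "complex_vec x' - \<i> *s complex_vec y' = complex_of_real q *s point_pair_vector Z W"
    unfolding moved
    by (simp add: vector_scalar_commute moebius_matrix_point_pair_vector[OF det fin \<open>z \<noteq> w\<close>] Z_def W_def)
  also have "\<dots> = complex_of_real k' *s
      (complex_vec (inv_stereo W - inv_stereo Z) - \<i> *s complex_vec (inv_stereo Z \<times> inv_stereo W))"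
    unfolding complex_chord[OF \<open>Z \<noteq> W\<close>] q[symmetric] by (simp only: vector_smult_assoc of_real_mult)
  also have "\<dots> = complex_vec (k' *\<^sub>R (inv_stereo W - inv_stereo Z)) -
      \<i> *s complex_vec (k' *\<^sub>R (inv_stereo Z \<times> inv_stereo W))"
    unfolding complex_vec_scaleR by (simp add: vec_eq_iff algebra_simps)
  finally have "conjugate_increments (inv_stereo Z) (inv_stereo W) k' x' y'"
    unfolding conjugate_increments_def by (auto dest: complex_vec_parts_eq)
  then show ?thesis
    using that q unfolding q_def Z_def W_def by blast
qed

text \<open>
  For unit vectors, \<open>(m + n) \<bullet> (n - m) = 0\<close> and \<open>m \<times> (n - m) = m \<times> n = n \<times> (n - m)\<close>; these give the
  edge equations of both surfaces at once.
\<close>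

lemma conjugate_increments_equations:
  assumes "conjugate_increments m n k x y" "norm m = 1" "norm n = 1"
  shows "(n - m) \<times> x = 0" "(m + n) \<bullet> x = 0" "y = m \<times> x" "y = n \<times> x" "m \<bullet> y = 0" "n \<bullet> y = 0"
proof -
  have "(m + n) \<bullet> (n - m) = n \<bullet> n - m \<bullet> m"
    by (simp add: algebra_simps inner_commute)
  then show "(m + n) \<bullet> x = 0"
    using assms by (simp add: conjugate_increments_def dot_square_norm)
  show "y = n \<times> x"
    using assms cross_skew[of n m] by (simp add: conjugate_increments_def cross_mult_right Cross3.right_diff_distrib)
qed (use assms in \<open>simp_all add: conjugate_increments_def cross_mult_right Cross3.right_diff_distrib dot_cross_self\<close>)

section \<open>Moebius transformations of conjugate pairs\<close>

theorem theorem5p1p2: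
  fixes M :: "('v, 'e, 'f) cell_decomposition"
    and f f' f\<Phi> f'\<Phi> :: "'f \<Rightarrow> real^3"
    and N N\<Phi> :: "'v \<Rightarrow> real^3"
    and z :: "'v \<Rightarrow> complex"
    and a b c d :: complex
  assumes "discrete_surface M"
    and "conjugate_pair M f f' N"
    and "nondegenerate M N"
    and "\<And>v. v \<in> vertices M \<Longrightarrow> N v $ 3 \<noteq> 1"
    and "\<And>v. v \<in> vertices M \<Longrightarrow> z v = stereo (N v)"
    and "a * d - b * c = 1"
    and "\<And>v. v \<in> vertices M \<Longrightarrow> c * z v + d \<noteq> 0"
    and "\<And>v. v \<in> vertices M \<Longrightarrow> N\<Phi> v = inv_stereo (moebius a b c d (z v))"
    and "admissible M N\<Phi>"
    and "\<And>\<phi>. \<phi> \<in> faces M \<Longrightarrow>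
           complex_vec (f\<Phi> \<phi>) - \<i> *s complex_vec (f'\<Phi> \<phi>) =
             moebius_matrix a b c d *v (complex_vec (f \<phi>) - \<i> *s complex_vec (f' \<phi>))"
  shows "A_minimal M f\<Phi> N\<Phi> \<and> C_minimal M f'\<Phi> N\<Phi> \<and> conjugate_pair M f\<Phi> f'\<Phi> N\<Phi>"
proof -
  interpret discrete_surface M by fact
  let ?I = "interior_darts M" and ?o = "origin M" and ?t = "target M"
  have ends: "?o e \<in> vertices M" "?t e \<in> vertices M" if "e \<in> darts M" for e
    using that origin_in opposite_in by (simp_all add: target_def)
  have dart: "e \<in> darts M" if "e \<in> ?I" for e
    using that by (simp add: interior_darts_def)
  have admissible: "admissible M N"
    using assms(2) by (simp add: conjugate_pair_def A_minimal_def)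
  have unit: "norm (N v) = 1" "norm (N\<Phi> v) = 1" if "v \<in> vertices M" for v
    using that admissible assms(9) by (simp_all add: admissible_def)
  have N: "N v = inv_stereo (z v)" if "v \<in> vertices M" for v
    using that assms(4,5) unit by (simp add: inv_stereo_stereo)
  have edge: "\<exists>k k'.
      conjugate_increments (N (?o e)) (N (?t e)) k (dual_diff M f e) (dual_diff M f' e) \<and>
      conjugate_increments (N\<Phi> (?o e)) (N\<Phi> (?t e)) k' (dual_diff M f\<Phi> e) (dual_diff M f'\<Phi> e) \<and>
      k' * (1 - N\<Phi> (?o e) \<bullet> N\<Phi> (?t e)) = k * (1 - N (?o e) \<bullet> N (?t e))"
    if e: "e \<in> ?I" for e
  proof -
    note v = ends[OF dart[OF e]]
    obtain l r where lr: "left_face M e = Some l" "right_face M e = Some r"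
      using e by (auto simp: interior_darts_def)
    then have faces: "l \<in> faces M" "r \<in> faces M"
      using left_face_in dart[OF e] opposite_in by (auto simp: right_face_def)
    obtain k where k:
      "conjugate_increments (N (?o e)) (N (?t e)) k (dual_diff M f e) (dual_diff M f' e)"
      using conjugate_pair_imp_conjugate_increments[OF assms(2,3) e] .
    have "complex_vec (dual_diff M f\<Phi> e) - \<i> *s complex_vec (dual_diff M f'\<Phi> e) =
        (complex_vec (f\<Phi> l) - \<i> *s complex_vec (f'\<Phi> l)) -
        (complex_vec (f\<Phi> r) - \<i> *s complex_vec (f'\<Phi> r))"
      by (simp add: dual_diff_def lr complex_vec_diff vec_eq_iff algebra_simps)
    also have "\<dots> = moebius_matrix a b c d *v
        ((complex_vec (f l) - \<i> *s complex_vec (f' l)) -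
         (complex_vec (f r) - \<i> *s complex_vec (f' r)))"
      by (simp only: assms(10)[OF faces(1)] assms(10)[OF faces(2)] matrix_vector_mult_diff_distrib)
    also have "(complex_vec (f l) - \<i> *s complex_vec (f' l)) -
         (complex_vec (f r) - \<i> *s complex_vec (f' r)) =
        complex_vec (dual_diff M f e) - \<i> *s complex_vec (dual_diff M f' e)"
      by (simp add: dual_diff_def lr complex_vec_diff vec_eq_iff algebra_simps)
    finally have moved: "complex_vec (dual_diff M f\<Phi> e) - \<i> *s complex_vec (dual_diff M f'\<Phi> e) =
        moebius_matrix a b c d *v
          (complex_vec (dual_diff M f e) - \<i> *s complex_vec (dual_diff M f' e))" .
    have "z (?o e) \<noteq> z (?t e)"
      using assms(3) dart[OF e] N[OF v(1)] N[OF v(2)] by (auto simp: nondegenerate_def)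
    from conjugate_increments_moebius[OF k[unfolded N[OF v(1)] N[OF v(2)]] moved assms(6)
        assms(7)[OF v(1)] assms(7)[OF v(2)] this]
    obtain k' where
      "conjugate_increments (N\<Phi> (?o e)) (N\<Phi> (?t e)) k' (dual_diff M f\<Phi> e) (dual_diff M f'\<Phi> e)"
      "k' * (1 - N\<Phi> (?o e) \<bullet> N\<Phi> (?t e)) = k * (1 - N (?o e) \<bullet> N (?t e))"
      unfolding assms(8)[OF v(1)] assms(8)[OF v(2)] N[OF v(1)] N[OF v(2)] by metis
    with k show ?thesis by blast
  qed
  have equations:
    "vdiff M N\<Phi> e \<times> dual_diff M f\<Phi> e = 0"
    "(N\<Phi> (?o e) + N\<Phi> (?t e)) \<bullet> dual_diff M f\<Phi> e = 0"
    "dual_diff M f'\<Phi> e = N\<Phi> (?o e) \<times> dual_diff M f\<Phi> e"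
    "dual_diff M f'\<Phi> e = N\<Phi> (?t e) \<times> dual_diff M f\<Phi> e"
    "N\<Phi> (?o e) \<bullet> dual_diff M f'\<Phi> e = 0"
    "N\<Phi> (?t e) \<bullet> dual_diff M f'\<Phi> e = 0" if e: "e \<in> ?I" for e
  proof -
    obtain k' where k':
      "conjugate_increments (N\<Phi> (?o e)) (N\<Phi> (?t e)) k' (dual_diff M f\<Phi> e) (dual_diff M f'\<Phi> e)"
      using edge[OF e] by blast
    from conjugate_increments_equations[OF k' unit(2)[OF ends(1)] unit(2)[OF ends(2)]] dart[OF e]
    show "vdiff M N\<Phi> e \<times> dual_diff M f\<Phi> e = 0"
      "(N\<Phi> (?o e) + N\<Phi> (?t e)) \<bullet> dual_diff M f\<Phi> e = 0"
      "dual_diff M f'\<Phi> e = N\<Phi> (?o e) \<times> dual_diff M f\<Phi> e"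
      "dual_diff M f'\<Phi> e = N\<Phi> (?t e) \<times> dual_diff M f\<Phi> e"
      "N\<Phi> (?o e) \<bullet> dual_diff M f'\<Phi> e = 0"
      "N\<Phi> (?t e) \<bullet> dual_diff M f'\<Phi> e = 0"
      by (simp_all only: vdiff_def)
  qed
  have curvature: "norm (dual_diff M f'\<Phi> e) * tan (dihedral_angle M f'\<Phi> N\<Phi> e / 2) =
      norm (dual_diff M f' e) * tan (dihedral_angle M f' N e / 2)" if e: "e \<in> ?I" for e
  proof -
    obtain k k' where
      k: "dual_diff M f' e = k *\<^sub>R (N (?o e) \<times> N (?t e))"
      and k': "dual_diff M f'\<Phi> e = k' *\<^sub>R (N\<Phi> (?o e) \<times> N\<Phi> (?t e))"
      and eq: "k' * (1 - N\<Phi> (?o e) \<bullet> N\<Phi> (?t e)) = k * (1 - N (?o e) \<bullet> N (?t e))"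
      using edge[OF e] unfolding conjugate_increments_def by blast
    show ?thesis
      using mean_curvature_term[OF _ _ _ k] mean_curvature_term[OF _ _ _ k'] eq
        admissible assms(9) dart[OF e] ends[OF dart[OF e]]
      by (simp add: admissible_def)
  qed
  have "mean_curvature M f'\<Phi> N\<Phi> v = mean_curvature M f' N v" if "v \<in> interior_vertices M" for v
    unfolding mean_curvature_def
    using curvature star_subset_interior_darts[OF that] by (intro sum.cong) auto
  then have "C_minimal M f'\<Phi> N\<Phi>"
    using assms(2,9) equations(5,6)
    by (simp add: C_minimal_def planar_faces_with_normal_def conjugate_pair_def)
  moreover have "A_minimal M f\<Phi> N\<Phi>"
    using assms(9) equations(1,2) by (simp add: A_minimal_def)
  ultimately show ?thesis
    using equations(3,4) by (simp add: conjugate_pair_def)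
qed

end
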